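(* Let $\mathcal Q(C_a,C_b)$ be a hypergraph product code with the logical Pauli operators given by SLT bases. All block matrices below have row and column blocks of sizes $\tilde n,\tilde m,\tilde n,\tilde m$. (i) For distinct left-sector logical qubits $(i_1,h_1,L)\ne(i_2,h_2,L)$, the two-qubit targeted logical CNOT with $(i_1,h_1,L)$ as the control and $(i_2,h_2,L)$ as the target has the symplectic representation $$F^{CNOT}_{(i_1,h_1,L)\to(i_2,h_2,L)}=\begin{bmatrix}I_{\tilde n}+\tilde D^{\top}&0&0&0\\0&I_{\tilde m}&0&0\\0&0&I_{\tilde n}+\tilde D&0\\0&0&0&I_{\tilde m}\end{bmatrix},\qquad \tilde D^{\top}=(a_{i_1}\otimes e_{h_1})^{\top}(e_{i_2}\otimes b_{h_2}).$$ (ii) For a left-sector logical qubit $(i,h,L)$ and a right-sector logical qubit $(j,l,R)$, the targeted logical CNOT with $(i,h,L)$ as the control and $(j,l,R)$ as the target has the symplectic representation $$F^{CNOT}_{(i,h,L)\to(j,l,R)}=\begin{bmatrix}I_{\tilde n}&\tilde D^{\top}&0&0\\0&I_{\tilde m}&0&0\\0&0&I_{\tilde n}&0\\0&0&\tilde D&I_{\tilde m}\end{bmatrix},\qquad \tilde D^{\top}=(a_i\otimes e_h)^{\top}(\alpha_j\otimes e_l).$$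
   Context: All vectors are row vectors over $\mathbb F_2$; $e_i$ denotes a standard basis vector of the appropriate length. Given binary matrices $H_a$ ($m_a\times n_a$) and $H_b$ ($m_b\times n_b$), parity-check matrices of classical codes $C_a=\ker H_a$, $C_b=\ker H_b$, the hypergraph product (HGP) code $\mathcal Q(C_a,C_b)$ is the CSS code on $n=\tilde n+\tilde m$ qubits, $\tilde n=n_an_b$, $\tilde m=m_am_b$, with $$H_X=[H_a\otimes I_{n_b}\,|\,I_{m_a}\otimes H_b^{\top}],\qquad H_Z=[I_{n_a}\otimes H_b\,|\,H_a^{\top}\otimes I_{m_b}].$$ The first $\tilde n$ qubits form the left sector, the last $\tilde m$ the right sector. Stabilizer generators correspond to the vectors $[H_X(r,:),0]$, $[0,H_Z(r,:)]$ in $\mathbb F_2^{2n}$, where $[a,b]$ represents up to phase the Pauli operator $X^{a_1}Z^{b_1}\otimes\cdots\otimes X^{a_n}Z^{b_n}$. An SLT basis of a subspace is a basis $\{a_i\}$ whose vectors are indexed by distinct coordinates $i$ (pivots) such that $(a_i)_i=1$ and $(a_{i'})_i=0$ for pivots $i'\ne i$. Let $\{a_i\},\{\alpha_j\},\{b_h\},\{\beta_l\}$ be SLT bases of $\ker H_a,\ker H_a^{\top},\ker H_b,\ker H_b^{\top}$. Logical qubits are labelled $(i,h,L)$ ($i$ a pivot of $\{a_i\}$, $h$ a pivot of $\{b_h\}$) and $(j,l,R)$ ($j$ a pivot of $\{\alpha_j\}$, $l$ a pivot of $\{\beta_l\}$). Logical Paulis: $\overline X_{i,h,L}$ is the $X$-type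 operator with vector $[\,e_i\otimes b_h\,|\,0\,]$, $\overline Z_{i,h,L}$ the $Z$-type operator with vector $[\,a_i\otimes e_h\,|\,0\,]$, $\overline X_{j,l,R}$ the $X$-type operator with vector $[\,0\,|\,\alpha_j\otimes e_l\,]$, $\overline Z_{j,l,R}$ the $Z$-type operator with vector $[\,0\,|\,e_j\otimes\beta_l\,]$. A matrix $F$ is a symplectic representation of a logical gate $g$ if $F\Omega F^{\top}=\Omega$ with $\Omega=\begin{bmatrix}0 & I_n \\ I_n & 0\end{bmatrix}$, right multiplication by $F$ fixes every stabilizer generator vector, and it maps the vectors in $\mathbb F_2^{2n}$ of the logical Paulis as $g$ prescribes modulo phases. The logical CNOT with control $c$ and target $t$ maps $\overline X_c\mapsto\overline X_c\overline X_t$, $\overline Z_t\mapsto\overline Z_c\overline Z_t$, and fixes all other logical Paulis $\overline X,\overline Z$. *)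

theory Defs
  imports "HOL-Analysis.Analysis" "HOL-Library.Z2"
begin

text \<open>
  The field with two elements is \<^typ>\<open>bit\<close>. An \<open>m \<times> n\<close> matrix has type \<open>bit^'n^'m\<close>.
  The coordinates of a tensor product are indexed by pairs, and those of a concatenation
  \<open>[u | v]\<close> by a disjoint sum; a row vector \<open>v\<close> is multiplied by a matrix from the right
  as \<open>v v* F\<close>, and \<open>e\<^sub>i\<close> is \<open>axis i 1\<close>.
\<close>

definition tensor_vec :: "bit^'n \<Rightarrow> bit^'k \<Rightarrow> bit^('n \<times> 'k)" (infixr \<open>\<otimes>\<^sub>v\<close> 75) where
  "x \<otimes>\<^sub>v y = (\<chi> p. x $ fst p * y $ snd p)"

definition tensor_mat :: "bit^'n^'m \<Rightarrow> bit^'k^'l \<Rightarrow> bit^('n \<times> 'k)^('m \<times> 'l)"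
    (infixr \<open>\<otimes>\<^sub>m\<close> 75) where
  "A \<otimes>\<^sub>m B = (\<chi> r c. A $ fst r $ fst c * B $ snd r $ snd c)"

definition append_vec :: "bit^'n \<Rightarrow> bit^'k \<Rightarrow> bit^('n + 'k)" where
  "append_vec u v = (\<chi> s. case s of Inl i \<Rightarrow> u $ i | Inr j \<Rightarrow> v $ j)"

definition append_cols :: "bit^'n^'m \<Rightarrow> bit^'k^'m \<Rightarrow> bit^('n + 'k)^'m" where
  "append_cols A B = (\<chi> r. append_vec (A $ r) (B $ r))"

definition block_mat ::
    "bit^'n^'m \<Rightarrow> bit^'k^'m \<Rightarrow> bit^'n^'l \<Rightarrow> bit^'k^'l \<Rightarrow> bit^('n + 'k)^('m + 'l)" where
  "block_mat A B C D =
     (\<chi> s. case s of Inl i \<Rightarrow> append_vec (A $ i) (B $ i) | Inr j \<Rightarrow> append_vec (C $ j) (D $ j))"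

text \<open>
  The matrix \<open>u\<^sup>T v\<close> of row vectors. The type of the inner dimension must be fixed to \<open>1\<close>,
  since \<^const>\<open>columnvector\<close> and \<^const>\<open>rowvector\<close> are polymorphic in it.
\<close>

definition outer :: "bit^'m \<Rightarrow> bit^'n \<Rightarrow> bit^'n^'m" where
  "outer u v = (columnvector u :: bit^1^'m) ** (rowvector v :: bit^'n^1)"

definition ker_mat :: "bit^'n^'m \<Rightarrow> (bit^'n) set" where
  "ker_mat H = {x. H *v x = 0}"

text \<open>\<open>P\<close> is the set of pivots; the values of \<open>a\<close> outside \<open>P\<close> are irrelevant.\<close>

definition SLT_basis :: "'n set \<Rightarrow> ('n \<Rightarrow> bit^'n) \<Rightarrow> (bit^'n) set \<Rightarrow> bool" where
  "SLT_basis P a W \<longleftrightarrow>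
     inj_on a P \<and> vec.independent (a ` P) \<and> vec.span (a ` P) = W \<and>
     (\<forall>i\<in>P. a i $ i = 1 \<and> (\<forall>i'\<in>P. i' \<noteq> i \<longrightarrow> a i $ i' = 0))"

definition HX ::
    "bit^'na^'ma \<Rightarrow> bit^'nb^'mb \<Rightarrow> bit^('na \<times> 'nb + 'ma \<times> 'mb)^('ma \<times> 'nb)" where
  "HX Ha Hb = append_cols (Ha \<otimes>\<^sub>m (mat 1 :: bit^'nb^'nb)) ((mat 1 :: bit^'ma^'ma) \<otimes>\<^sub>m transpose Hb)"

definition HZ ::
    "bit^'na^'ma \<Rightarrow> bit^'nb^'mb \<Rightarrow> bit^('na \<times> 'nb + 'ma \<times> 'mb)^('na \<times> 'mb)" where
  "HZ Ha Hb = append_cols ((mat 1 :: bit^'na^'na) \<otimes>\<^sub>m Hb) (transpose Ha \<otimes>\<^sub>m (mat 1 :: bit^'mb^'mb))"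

text \<open>
  A Pauli operator on qubits indexed by \<open>'q\<close> is represented, up to phase, by the vector
  \<open>[a, b]\<close> of type \<open>bit^('q + 'q)\<close>, so products of operators correspond to sums of vectors.
\<close>

definition X_type :: "bit^'q \<Rightarrow> bit^('q + 'q)" where
  "X_type x = append_vec x 0"

definition Z_type :: "bit^'q \<Rightarrow> bit^('q + 'q)" where
  "Z_type z = append_vec 0 z"

definition stabilizer_generators ::
    "bit^'na^'ma \<Rightarrow> bit^'nb^'mb \<Rightarrow>
     (bit^(('na \<times> 'nb + 'ma \<times> 'mb) + ('na \<times> 'nb + 'ma \<times> 'mb))) set" where
  "stabilizer_generators Ha Hb =
     {X_type (row r (HX Ha Hb)) | r. True} \<union> {Z_type (row r (HZ Ha Hb)) | r. True}"

datatype ('na, 'nb, 'ma, 'mb) logical_qubit = LeftQ 'na 'nb | RightQ 'ma 'mb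

datatype 'l logical_pauli = LX 'l | LZ 'l

definition logical_qubits ::
    "'na set \<Rightarrow> 'nb set \<Rightarrow> 'ma set \<Rightarrow> 'mb set \<Rightarrow> ('na, 'nb, 'ma, 'mb) logical_qubit set" where
  "logical_qubits Pa Pb P\<alpha> P\<beta> =
     {LeftQ i h | i h. i \<in> Pa \<and> h \<in> Pb} \<union> {RightQ j l | j l. j \<in> P\<alpha> \<and> l \<in> P\<beta>}"

definition logical_paulis :: "'l set \<Rightarrow> 'l logical_pauli set" where
  "logical_paulis Q = LX ` Q \<union> LZ ` Q"

fun logical_vec ::
    "('na \<Rightarrow> bit^'na) \<Rightarrow> ('nb \<Rightarrow> bit^'nb) \<Rightarrow> ('ma \<Rightarrow> bit^'ma) \<Rightarrow> ('mb \<Rightarrow> bit^'mb) \<Rightarrow>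
     ('na, 'nb, 'ma, 'mb) logical_qubit logical_pauli \<Rightarrow>
     bit^(('na \<times> 'nb + 'ma \<times> 'mb) + ('na \<times> 'nb + 'ma \<times> 'mb))" where
  "logical_vec a b \<alpha> \<beta> (LX (LeftQ i h)) = X_type (append_vec (axis i 1 \<otimes>\<^sub>v b h) 0)"
| "logical_vec a b \<alpha> \<beta> (LZ (LeftQ i h)) = Z_type (append_vec (a i \<otimes>\<^sub>v axis h 1) 0)"
| "logical_vec a b \<alpha> \<beta> (LX (RightQ j l)) = X_type (append_vec 0 (\<alpha> j \<otimes>\<^sub>v axis l 1))"
| "logical_vec a b \<alpha> \<beta> (LZ (RightQ j l)) = Z_type (append_vec 0 (axis j 1 \<otimes>\<^sub>v \<beta> l))"

text \<open>
  Modulo phases, a logical gate is given by the images of the logical Paulis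
  \<open>LX q\<close>, \<open>LZ q\<close>; each image is a product of logical Paulis, recorded as the set of its factors
  (operators square to the identity and commute up to phase).
\<close>

fun logical_CNOT :: "'l \<Rightarrow> 'l \<Rightarrow> 'l logical_pauli \<Rightarrow> 'l logical_pauli set" where
  "logical_CNOT c t (LX q) = (if q = c then {LX c, LX t} else {LX q})"
| "logical_CNOT c t (LZ q) = (if q = t then {LZ c, LZ t} else {LZ q})"

definition symplectic_form :: "bit^('q::finite + 'q)^('q + 'q)" where
  "symplectic_form = block_mat 0 (mat 1) (mat 1) 0"

definition symplectic_matrix :: "bit^('q::finite + 'q)^('q + 'q) \<Rightarrow> bool" where
  "symplectic_matrix F \<longleftrightarrow> F ** symplectic_form ** transpose F = symplectic_form"

definition symplectic_representation ::
    "(bit^('q::finite + 'q)) set \<Rightarrow> 'p set \<Rightarrow> ('p \<Rightarrow> bit^('q + 'q)) \<Rightarrow> ('p \<Rightarrow> 'p set) \<Rightarrow>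
     bit^('q::finite + 'q)^('q + 'q) \<Rightarrow> bool" where
  "symplectic_representation S L v g F \<longleftrightarrow>
     symplectic_matrix F \<and>
     (\<forall>s\<in>S. s v* F = s) \<and>
     (\<forall>p\<in>L. v p v* F = (\<Sum>p'\<in>g p. v p'))"

definition HGP_symplectic_representation ::
    "bit^'na^'ma \<Rightarrow> bit^'nb^'mb \<Rightarrow>
     'na set \<Rightarrow> ('na \<Rightarrow> bit^'na) \<Rightarrow> 'nb set \<Rightarrow> ('nb \<Rightarrow> bit^'nb) \<Rightarrow>
     'ma set \<Rightarrow> ('ma \<Rightarrow> bit^'ma) \<Rightarrow> 'mb set \<Rightarrow> ('mb \<Rightarrow> bit^'mb) \<Rightarrow>
     (('na, 'nb, 'ma, 'mb) logical_qubit logical_pauli \<Rightarrow>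
      ('na, 'nb, 'ma, 'mb) logical_qubit logical_pauli set) \<Rightarrow>
     bit^(('na \<times> 'nb + 'ma \<times> 'mb) + ('na \<times> 'nb + 'ma \<times> 'mb))
        ^(('na \<times> 'nb + 'ma \<times> 'mb) + ('na \<times> 'nb + 'ma \<times> 'mb)) \<Rightarrow> bool" where
  "HGP_symplectic_representation Ha Hb Pa a Pb b P\<alpha> \<alpha> P\<beta> \<beta> g F \<longleftrightarrow>
     symplectic_representation (stabilizer_generators Ha Hb)
       (logical_paulis (logical_qubits Pa Pb P\<alpha> P\<beta>)) (logical_vec a b \<alpha> \<beta>) g F"

end

theory Submission
  imports Defs
begin

text \<open>
  Both matrices are transvections: with \<open>u\<close> the vector of the logical \<open>Z\<close> of the control and \<open>w\<close>
  that of the logical \<open>X\<close> of the target, they equal \<open>diag (I + u\<^sup>T w, I + w\<^sup>T u)\<close> and send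
  \<open>[x, z]\<close> to \<open>[x + (x \<cdot> u) w, z + (z \<cdot> w) u]\<close>. Stabilizers are fixed since
  \<open>H\<^sub>X u\<^sup>T = 0\<close> and \<open>H\<^sub>Z w\<^sup>T = 0\<close>, the logical operators are mapped correctly since SLT bases make
  the logical \<open>X\<close> and \<open>Z\<close> vectors dual to each other, and the matrix is symplectic since
  \<open>u \<cdot> w = 0\<close> for distinct control and target.
\<close>

text \<open>Arithmetic on \<^typ>\<open>bit\<close> is normalized as in any field, not through bit operations.\<close>

declare add_bit_eq_xor [simp del] mult_bit_eq_and [simp del]

section \<open>Dot products, outer products and block matrices over F_2\<close>

lemma sum_UNIV_Plus:
  fixes f :: "'a::finite + 'b::finite \<Rightarrow> 'c::comm_monoid_add"
  shows "sum f UNIV = (\<Sum>i\<in>UNIV. f (Inl i)) + (\<Sum>j\<in>UNIV. f (Inr j))"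
  using sum.Plus[of "UNIV :: 'a set" "UNIV :: 'b set" f] by (simp add : comp_def)

definition dot :: "bit^'n \<Rightarrow> bit^'n \<Rightarrow> bit" where
  "dot x y = (\<Sum>i\<in>UNIV. x $ i * y $ i)"

lemma dot_commute: "dot x y = dot y x"
  by (simp add: dot_def mult.commute)

lemma dot_zero [simp]: "dot x 0 = 0" "dot 0 x = 0"
  by (simp_all add: dot_def)

lemma dot_axis [simp]: "dot x (axis i 1) = x $ i" "dot (axis i 1) x = x $ i"
  by (simp_all add: dot_def axis_def if_distrib if_distribR cong: if_cong)

lemma dot_append_vec:
  "dot (append_vec x y) (append_vec u v) = dot x u + dot y v"
  by (simp add: dot_def append_vec_def sum_UNIV_Plus)

lemma dot_tensor_vec: "dot (x \<otimes>\<^sub>v y) (u \<otimes>\<^sub>v v) = dot x u * dot y v"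
proof -
  have "dot (x \<otimes>\<^sub>v y) (u \<otimes>\<^sub>v v)
      = (\<Sum>i\<in>UNIV. \<Sum>j\<in>UNIV. (x $ i * u $ i) * (y $ j * v $ j))"
    by (simp add: dot_def tensor_vec_def sum.cartesian_product
        case_prod_unfold mult_ac)
  then show ?thesis
    by (simp add: dot_def sum_product)
qed

lemma append_vec_zero [simp]: "append_vec 0 0 = 0"
  by (simp add: append_vec_def vec_eq_iff split: sum.split)

lemma append_vec_add: "append_vec (x + x') (y + y') = append_vec x y + append_vec x' y'"
  by (simp add: append_vec_def vec_eq_iff split: sum.split)

lemma outer_nth: "outer u v $ i $ j = u $ i * v $ j"
  by (simp add: outer_def matrix_matrix_mult_def columnvector_def rowvector_def)

lemma transpose_outer: "transpose (outer u v) = outer v u"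
  by (simp add: vec_eq_iff transpose_def outer_nth mult.commute)

text \<open>The inner product v x^T is a scalar. It is applied row by row, since \<open>*s\<close>
  scales vectors rather than matrices.\<close>

lemma outer_mult_outer: "outer u v ** outer x y = (\<chi> i. dot v x *s (outer u y $ i))"
  by (simp add: vec_eq_iff matrix_matrix_mult_def outer_nth dot_def sum_distrib_right
      sum_distrib_left mult_ac)

lemma vec_mult_transvection: "x v* (mat 1 + outer u w) = x + dot x u *s w"
proof -
  have "x v* outer u w = dot x u *s w"
    by (simp add: vec_eq_iff vector_matrix_mult_def outer_nth dot_def sum_distrib_left mult_ac)
  then show ?thesis
    by (simp add: vector_matrix_mult_add_rdistrib)
qed

lemma matrix_add_rdistrib:
  fixes A B :: "'a::semiring_1^'n^'m" and C :: "'a^'k^'n"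
  shows "(A + B) ** C = A ** C + B ** C"
  by (simp add: vec_eq_iff matrix_matrix_mult_def distrib_right sum.distrib)

text \<open>Expanding the square leaves twice \<open>outer u w\<close>, which vanishes in
  characteristic 2, and (w . u) times \<open>outer u w\<close>, which vanishes by
  orthogonality.\<close>

lemma transvection_involution:
  assumes "dot u w = 0"
  shows "(mat 1 + outer u w) ** (mat 1 + outer u w) = mat 1"
proof -
  have "outer u w ** outer u w = 0"
    using assms by (simp add: outer_mult_outer dot_commute[of w] vec_eq_iff)
  moreover have "outer u w + outer u w = 0"
    by (simp add: vec_eq_iff)
  ultimately show ?thesis
    by (simp add: matrix_add_ldistrib matrix_add_rdistrib add.assoc)
qed

lemma block_mat_mult:
  "block_mat A B C D ** block_mat A' B' C' D' =
   block_mat (A ** A' + B ** C') (A ** B' + B ** D') (C ** A' + D ** C') (C ** B' + D ** D')"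
  by (simp add: vec_eq_iff block_mat_def append_vec_def matrix_matrix_mult_def sum_UNIV_Plus
      split: sum.split)

lemma transpose_block_mat:
  "transpose (block_mat A B C D) =
   block_mat (transpose A) (transpose C) (transpose B) (transpose D)"
  by (simp add: vec_eq_iff block_mat_def append_vec_def transpose_def split: sum.split)

lemma append_vec_mult_block_mat:
  "append_vec x y v* block_mat A B C D = append_vec (x v* A + y v* C) (x v* B + y v* D)"
  by (simp add: vec_eq_iff block_mat_def append_vec_def vector_matrix_mult_def sum_UNIV_Plus
      split: sum.split)

section \<open>The CNOT matrix of a pair of vectors\<close>

definition CNOT_mat :: "bit^'q \<Rightarrow> bit^'q \<Rightarrow> bit^('q::finite + 'q)^('q + 'q)" where
  "CNOT_mat u w = block_mat (mat 1 + outer u w) 0 0 (mat 1 + outer w u)"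

lemma X_type_mult_CNOT_mat: "X_type x v* CNOT_mat u w = X_type (x + dot x u *s w)"
  by (simp add: X_type_def CNOT_mat_def append_vec_mult_block_mat vec_mult_transvection)

lemma Z_type_mult_CNOT_mat: "Z_type z v* CNOT_mat u w = Z_type (z + dot z w *s u)"
  by (simp add: Z_type_def CNOT_mat_def append_vec_mult_block_mat vec_mult_transvection)

lemma matrix_mult_zero: "(0::bit^'n^'m) ** A = 0" "B ** (0::bit^'n^'m) = 0"
  by (simp_all add: vec_eq_iff matrix_matrix_mult_def)

text \<open>With A = I + u^T w the matrix is diag(A, A^T), so conjugating the symplectic form gives
  the off-diagonal blocks A A and A^T A^T. Both are the identity because transvections along
  orthogonal vectors are involutions.\<close>

lemma symplectic_CNOT_mat:
  assumes "dot u w = 0"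
  shows "symplectic_matrix (CNOT_mat u w)"
proof -
  have tr: "transpose (mat 1 + outer x y) = mat 1 + outer y x" for x y :: "bit^'a"
    by (simp add: vec_eq_iff transpose_def mat_def outer_nth mult.commute)
  have z: "transpose 0 = (0 :: bit^'a^'a)"
    by (simp add: vec_eq_iff transpose_def)
  from assms show ?thesis
    by (simp add: symplectic_matrix_def CNOT_mat_def symplectic_form_def transpose_block_mat
        block_mat_mult tr z matrix_mult_zero transvection_involution dot_commute[of w])
qed

lemma X_type_zero [simp]: "X_type 0 = 0" and Z_type_zero [simp]: "Z_type 0 = 0"
  by (simp_all add: X_type_def Z_type_def)

lemma X_type_add: "X_type (x + y) = X_type x + X_type y"
  by (simp add: X_type_def append_vec_add[symmetric])

lemma Z_type_add: "Z_type (x + y) = Z_type x + Z_type y"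
  by (simp add: Z_type_def append_vec_add[symmetric])

text \<open>Isolates what the code has to supply: duality of the logical vectors, and orthogonality
  of the generators to the two vectors that define the transvection.\<close>

lemma symplectic_representation_CNOT_mat:
  fixes x z :: "'l \<Rightarrow> bit^'q"
  assumes "c \<noteq> t" "c \<in> Q" "t \<in> Q"
    and vX: "\<And>q. v (LX q) = X_type (x q)" and vZ: "\<And>q. v (LZ q) = Z_type (z q)"
    and dual: "\<And>q q'. q \<in> Q \<Longrightarrow> q' \<in> Q \<Longrightarrow> dot (x q) (z q') = of_bool (q = q')"
    and S: "\<And>s. s \<in> S \<Longrightarrow> (\<exists>y. s = X_type y \<and> dot y (z c) = 0) \<or>
                               (\<exists>y. s = Z_type y \<and> dot y (x t) = 0)"
  shows "symplectic_representation S (logical_paulis Q) v (logical_CNOT c t)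
           (CNOT_mat (z c) (x t))"
  unfolding symplectic_representation_def
proof (intro conjI ballI)
  show "symplectic_matrix (CNOT_mat (z c) (x t))"
    using assms(1-3) by (intro symplectic_CNOT_mat) (simp add: dot_commute[of "z c"] dual)
  show "s v* CNOT_mat (z c) (x t) = s" if "s \<in> S" for s
    using S[OF that] by (auto simp: X_type_mult_CNOT_mat Z_type_mult_CNOT_mat)
  show "v p v* CNOT_mat (z c) (x t) = (\<Sum>p'\<in>logical_CNOT c t p. v p')"
    if "p \<in> logical_paulis Q" for p
    \<comment> \<open>Duality makes the correction term nonzero only for the X of \<open>c\<close>
      and the Z of \<open>t\<close>. There the image set has two distinct elements because
      \<open>c\<close> and \<open>t\<close> differ, so the sum has exactly two terms.\<close>
    using that assms(1-3)
    by (auto simp: logical_paulis_def vX vZ X_type_mult_CNOT_mat Z_type_mult_CNOT_mat dual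
        dot_commute[of "z _"] X_type_add Z_type_add)
qed

section \<open>Logical operators and stabilizers of the hypergraph product code\<close>

fun logical_X ::
    "('nb::finite \<Rightarrow> bit^'nb) \<Rightarrow> ('ma::finite \<Rightarrow> bit^'ma) \<Rightarrow>
     ('na::finite, 'nb, 'ma, 'mb::finite) logical_qubit \<Rightarrow> bit^('na \<times> 'nb + 'ma \<times> 'mb)" where
  "logical_X b \<alpha> (LeftQ i h) = append_vec (axis i 1 \<otimes>\<^sub>v b h) 0"
| "logical_X b \<alpha> (RightQ j l) = append_vec 0 (\<alpha> j \<otimes>\<^sub>v axis l 1)"

fun logical_Z ::
    "('na::finite \<Rightarrow> bit^'na) \<Rightarrow> ('mb::finite \<Rightarrow> bit^'mb) \<Rightarrow>
     ('na, 'nb::finite, 'ma::finite, 'mb) logical_qubit \<Rightarrow> bit^('na \<times> 'nb + 'ma \<times> 'mb)" where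
  "logical_Z a \<beta> (LeftQ i h) = append_vec (a i \<otimes>\<^sub>v axis h 1) 0"
| "logical_Z a \<beta> (RightQ j l) = append_vec 0 (axis j 1 \<otimes>\<^sub>v \<beta> l)"

text \<open>Supplies the assumption \<open>vX\<close> of the abstract criterion, as the next lemma
  does for \<open>vZ\<close>; duality can then be stated for vectors of length n.\<close>

lemma logical_vec_LX: "logical_vec a b \<alpha> \<beta> (LX q) = X_type (logical_X b \<alpha> q)"
  by (cases q) auto

lemma logical_vec_LZ: "logical_vec a b \<alpha> \<beta> (LZ q) = Z_type (logical_Z a \<beta> q)"
  by (cases q) auto

lemma SLT_basis_nth:
  assumes "SLT_basis P a W" "i \<in> P" "i' \<in> P"
  shows "a i $ i' = of_bool (i = i')"
  using assms by (auto simp: SLT_basis_def)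

lemma SLT_basis_ker_mat:
  assumes "SLT_basis P a (ker_mat H)" "i \<in> P"
  shows "dot (row r H) (a i) = 0"
proof -
  have "a i \<in> ker_mat H"
    using assms vec.span_base[of "a i" "a ` P"] by (simp add: SLT_basis_def)
  then show ?thesis
    by (simp add: ker_mat_def vec_eq_iff matrix_vector_mult_def dot_def row_def)
qed

text \<open>Different sectors have disjoint supports. Within the left sector the product factors as
  (a_i')_i (b_h)_h', and within the right one as (\<alpha>_j)_j' (\<beta>_l)_l'; the pivot
  conditions turn each factor into a Kronecker delta.\<close>

lemma logical_X_Z_dual:
  assumes "SLT_basis Pa a Wa" "SLT_basis P\<alpha> \<alpha> W\<alpha>" "SLT_basis Pb b Wb" "SLT_basis P\<beta> \<beta> W\<beta>"
    and "q \<in> logical_qubits Pa Pb P\<alpha> P\<beta>" "q' \<in> logical_qubits Pa Pb P\<alpha> P\<beta>"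
  shows "dot (logical_X b \<alpha> q) (logical_Z a \<beta> q') = of_bool (q = q')"
  using assms(5,6)
  by (auto simp: logical_qubits_def dot_append_vec dot_tensor_vec
      SLT_basis_nth[OF assms(1)] SLT_basis_nth[OF assms(2)]
      SLT_basis_nth[OF assms(3)] SLT_basis_nth[OF assms(4)])

lemma row_tensor_mat: "row r (A \<otimes>\<^sub>m B) = row (fst r) A \<otimes>\<^sub>v row (snd r) B"
  by (simp add: vec_eq_iff row_def tensor_mat_def tensor_vec_def)

lemma row_append_cols: "row r (append_cols A B) = append_vec (row r A) (row r B)"
  by (simp add: vec_eq_iff row_def append_cols_def append_vec_def split: sum.split)

text \<open>The left half of the row has a row of \<open>Ha\<close> as first tensor factor, which
  annihilates \<open>a i\<close>; the right half meets zero.\<close>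

lemma dot_row_HX:
  assumes "SLT_basis Pa a (ker_mat Ha)" "i \<in> Pa"
  shows "dot (row r (HX Ha Hb)) (logical_Z a \<beta> (LeftQ i h)) = 0"
  by (simp add: HX_def row_append_cols row_tensor_mat dot_append_vec dot_tensor_vec
      SLT_basis_ker_mat[OF assms])

text \<open>A left target is annihilated through \<open>b h\<close> in the kernel of
  \<open>Hb\<close>, a right target through \<open>\<alpha> j\<close> in the kernel of the transpose
  of \<open>Ha\<close>.\<close>

lemma dot_row_HZ:
  assumes "SLT_basis P\<alpha> \<alpha> (ker_mat (transpose Ha))" "SLT_basis Pb b (ker_mat Hb)"
    and "q \<in> logical_qubits Pa Pb P\<alpha> P\<beta>"
  shows "dot (row r (HZ Ha Hb)) (logical_X b \<alpha> q) = 0"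
  using assms(3)
  \<comment> \<open>\<open>row_transpose\<close> would turn rows of the transpose of
    \<open>Ha\<close> into columns of \<open>Ha\<close>, and the kernel fact would no longer
    match.\<close>
  by (auto simp: logical_qubits_def HZ_def row_append_cols row_tensor_mat dot_append_vec
      dot_tensor_vec SLT_basis_ker_mat[OF assms(1)] SLT_basis_ker_mat[OF assms(2)]
      simp del: row_transpose)

text \<open>The target may lie in either sector, so both claims are instances.\<close>

lemma HGP_symplectic_representation_CNOT:
  assumes "SLT_basis Pa a (ker_mat Ha)" "SLT_basis P\<alpha> \<alpha> (ker_mat (transpose Ha))"
    and "SLT_basis Pb b (ker_mat Hb)" "SLT_basis P\<beta> \<beta> (ker_mat (transpose Hb))"
    and "i \<in> Pa" "h \<in> Pb" "t \<in> logical_qubits Pa Pb P\<alpha> P\<beta>" "LeftQ i h \<noteq> t"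
  shows "HGP_symplectic_representation Ha Hb Pa a Pb b P\<alpha> \<alpha> P\<beta> \<beta> (logical_CNOT (LeftQ i h) t)
           (CNOT_mat (logical_Z a \<beta> (LeftQ i h)) (logical_X b \<alpha> t))"
  unfolding HGP_symplectic_representation_def
proof (rule symplectic_representation_CNOT_mat)
  show "LeftQ i h \<in> logical_qubits Pa Pb P\<alpha> P\<beta>"
    using assms by (simp add: logical_qubits_def)
  show "(\<exists>y. s = X_type y \<and> dot y (logical_Z a \<beta> (LeftQ i h)) = 0) \<or>
        (\<exists>y. s = Z_type y \<and> dot y (logical_X b \<alpha> t) = 0)"
    if "s \<in> stabilizer_generators Ha Hb" for s
    using that dot_row_HX[OF assms(1,5)] dot_row_HZ[OF assms(2,3,7)]
    unfolding stabilizer_generators_def by blast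
qed (use assms in \<open>simp_all add: logical_vec_LX logical_vec_LZ logical_X_Z_dual\<close>)

section \<open>Sector block form of the transvections\<close>

lemma transvection_left_left:
  "mat 1 + outer (append_vec u 0) (append_vec w 0) =
   block_mat (mat 1 + outer u w) 0 0 (mat 1)"
  by (simp add: vec_eq_iff block_mat_def append_vec_def mat_def outer_nth split: sum.split)

text \<open>The first argument of \<open>outer\<close> selects the row block and the second the
  column block, so vectors from different sectors give an off-diagonal block.\<close>

lemma transvection_left_right:
  "mat 1 + outer (append_vec u 0) (append_vec 0 w) = block_mat (mat 1) (outer u w) 0 (mat 1)"
  by (simp add: vec_eq_iff block_mat_def append_vec_def mat_def outer_nth split: sum.split)

lemma transvection_right_left:
  "mat 1 + outer (append_vec 0 w) (append_vec u 0) = block_mat (mat 1) 0 (outer w u) (mat 1)"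
  by (simp add: vec_eq_iff block_mat_def append_vec_def mat_def outer_nth split: sum.split)

theorem proposition4p7:
  fixes Ha :: "bit^'na^'ma" and Hb :: "bit^'nb^'mb"
    and Pa :: "'na set" and a :: "'na \<Rightarrow> bit^'na"
    and P\<alpha> :: "'ma set" and \<alpha> :: "'ma \<Rightarrow> bit^'ma"
    and Pb :: "'nb set" and b :: "'nb \<Rightarrow> bit^'nb"
    and P\<beta> :: "'mb set" and \<beta> :: "'mb \<Rightarrow> bit^'mb"
  assumes "SLT_basis Pa a (ker_mat Ha)"
    and "SLT_basis P\<alpha> \<alpha> (ker_mat (transpose Ha))"
    and "SLT_basis Pb b (ker_mat Hb)"
    and "SLT_basis P\<beta> \<beta> (ker_mat (transpose Hb))"
  shows "(\<forall>i1\<in>Pa. \<forall>h1\<in>Pb. \<forall>i2\<in>Pa. \<forall>h2\<in>Pb. (i1, h1) \<noteq> (i2, h2) \<longrightarrow>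
            (let DT = outer (a i1 \<otimes>\<^sub>v axis h1 1) (axis i2 1 \<otimes>\<^sub>v b h2); D = transpose DT in
             HGP_symplectic_representation Ha Hb Pa a Pb b P\<alpha> \<alpha> P\<beta> \<beta>
               (logical_CNOT (LeftQ i1 h1) (LeftQ i2 h2))
               (block_mat
                  (block_mat (mat 1 + DT) 0
                             0            (mat 1))
                  0
                  0
                  (block_mat (mat 1 + D) 0
                             0           (mat 1))))) \<and>
         (\<forall>i\<in>Pa. \<forall>h\<in>Pb. \<forall>j\<in>P\<alpha>. \<forall>l\<in>P\<beta>.
            (let DT = outer (a i \<otimes>\<^sub>v axis h 1) (\<alpha> j \<otimes>\<^sub>v axis l 1); D = transpose DT in
             HGP_symplectic_representation Ha Hb Pa a Pb b P\<alpha> \<alpha> P\<beta> \<beta>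
               (logical_CNOT (LeftQ i h) (RightQ j l))
               (block_mat
                  (block_mat (mat 1) DT
                             0       (mat 1))
                  0
                  0
                  (block_mat (mat 1) 0
                             D       (mat 1)))))"
proof (intro conjI ballI impI)
  fix i1 h1 i2 h2
  assume "i1 \<in> Pa" "h1 \<in> Pb" "i2 \<in> Pa" "h2 \<in> Pb" "(i1, h1) \<noteq> (i2, h2)"
  then show "let DT = outer (a i1 \<otimes>\<^sub>v axis h1 1) (axis i2 1 \<otimes>\<^sub>v b h2); D = transpose DT in
      HGP_symplectic_representation Ha Hb Pa a Pb b P\<alpha> \<alpha> P\<beta> \<beta>
        (logical_CNOT (LeftQ i1 h1) (LeftQ i2 h2))
        (block_mat (block_mat (mat 1 + DT) 0 0 (mat 1)) 0 0
                   (block_mat (mat 1 + D) 0 0 (mat 1)))"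
    using HGP_symplectic_representation_CNOT[OF assms, of i1 h1 "LeftQ i2 h2"]
    by (simp add: Let_def logical_qubits_def CNOT_mat_def transpose_outer transvection_left_left)
next
  fix i h j l
  assume "i \<in> Pa" "h \<in> Pb" "j \<in> P\<alpha>" "l \<in> P\<beta>"
  then show "let DT = outer (a i \<otimes>\<^sub>v axis h 1) (\<alpha> j \<otimes>\<^sub>v axis l 1); D = transpose DT in
      HGP_symplectic_representation Ha Hb Pa a Pb b P\<alpha> \<alpha> P\<beta> \<beta>
        (logical_CNOT (LeftQ i h) (RightQ j l))
        (block_mat (block_mat (mat 1) DT 0 (mat 1)) 0 0
                   (block_mat (mat 1) 0 D (mat 1)))"
    using HGP_symplectic_representation_CNOT[OF assms, of i h "RightQ j l"]
    by (simp add: Let_def logical_qubits_def CNOT_mat_def transpose_outer transvection_left_right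
        transvection_right_left)
qed

end
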